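(* Let $0<\alpha<1$, and consider a 3D regular cubical complex on a parallelepiped $\Omega=[x_{\min},x_{\max}]\times[y_{\min},y_{\max}]\times[z_{\min},z_{\max}]$. The fractional discrete exterior derivative operators $$\mathbb{D}_p^\alpha=\mathbb{I}^{1-\alpha}_{p+1}\,\mathbb{D}_p\,\big(\mathbb{I}^{1-\alpha}_{p}\big)^{-1},\qquad p=0,1,2,$$ satisfy $$\mathbb{D}_{p+1}^\alpha\,\mathbb{D}_p^\alpha=0\qquad\text{for } p=0,1.$$
   Context: Complex: fix subdivisions $x_{\min}=x_1<\cdots<x_{n_x+1}=x_{\max}$, $y_{\min}=y_1<\cdots<y_{n_y+1}=y_{\max}$, $z_{\min}=z_1<\cdots<z_{n_z+1}=z_{\max}$. The cells are the products of subdivision points and subdivision intervals: nodes ($0$-cells), edges ($1$-cells, parallel to the $x$, $y$ or $z$ axis), faces ($2$-cells, parallel to the $yz$, $xz$ or $xy$ plane), and volumes ($3$-cells). Let $n_p$ be the number of $p$-cells $\sigma^p_i$ and $|\sigma|$ the length/area/volume of $\sigma$. Edges are oriented in the direction of increasing coordinate, faces by $dy\wedge dz$, $dz\wedge dx$, $dx\wedge dy$, and volumes by $dx\wedge dy\wedge dz$. Within each cell type, cells are indexed by $(i,j,k)$ in lexicographic order, compatibly with Kronecker products (factors ordered $x,y,z$); edges are listed in blocks $x,y,z$ and faces in blocks $yz,xz,xy$. Discrete exterior derivative: $\mathbb{D}_p\in\mathbb{R}^{n_{p+1}\times n_p}$ is the signed incidence matrix: $\mathbb{D}_p(i,j)=0$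 if $\sigma^p_j$ is not on the boundary of $\sigma^{p+1}_i$, and $+1$ (resp. $-1$) if it is on the boundary and its orientation is (resp. is not) coherent with that induced by $\sigma^{p+1}_i$. In particular, an edge has $+1$ at its endpoint of larger coordinate and $-1$ at the other endpoint. Generalized incidence: $\mathbb{D}_{0\to1}=\mathbb{D}_0$; for $q=2,3$, $\mathbb{D}_{0\to q}\in\mathbb{R}^{n_q\times n_0}$ has $(i,j)$ entry $0$ if node $\sigma^0_j$ is not a vertex of $\sigma^q_i$, and otherwise the product of $\mathbb{D}_0(k,j)$ over the $q$ edges $\sigma^1_k$ of $\sigma^q_i$ that contain $\sigma^0_j$. Split into row blocks by cell type: $\mathbb{D}_{0}=(\mathbb{B}_{1,x};\mathbb{B}_{1,y};\mathbb{B}_{1,z})$, $\mathbb{D}_{0\to2}=(\mathbb{B}_{2,yz};\mathbb{B}_{2,xz};\mathbb{B}_{2,xy})$. Put $\mathbb{B}_1=\operatorname{diag}(\mathbb{B}_{1,x},\mathbb{B}_{1,y},\mathbb{B}_{1,z})$, $\mathbb{B}_2=\operatorname{diag}(\mathbb{B}_{2,yz},\mathbb{B}_{2,xz},\mathbb{B}_{2,xy})$, $\mathbb{B}_3=\mathbb{D}_{0\to3}$. Discrete fractional integrals: for $\beta>0$ let $M_x^{1+\beta}\in\mathbb{R}^{(n_x+1)\times n_x}$ have entries $$(M_x^{1+\beta})_{i,i'}=\frac{(x_i-x_{i'})^{1+\beta}-(x_i-x_{i'+1})^{1+\beta}}{\Gamma(2+\beta)}\ \text{ if } i'<i,\qquad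 0\ \text{ otherwise},$$ and define $M_y^{1+\beta}$, $M_z^{1+\beta}$ likewise from the $y$- and $z$-subdivisions. With $\otimes$ the Kronecker product and $I_n$ the $n\times n$ identity, set $$\mathbb{M}_1^{1+\beta}=\operatorname{diag}\big(M_x^{1+\beta}\otimes I_{n_y+1}\otimes I_{n_z+1},\ I_{n_x+1}\otimes M_y^{1+\beta}\otimes I_{n_z+1},\ I_{n_x+1}\otimes I_{n_y+1}\otimes M_z^{1+\beta}\big),$$ $$\mathbb{M}_2^{1+\beta}=\operatorname{diag}\big(I_{n_x+1}\otimes M_y^{1+\beta}\otimes M_z^{1+\beta},\ M_x^{1+\beta}\otimes I_{n_y+1}\otimes M_z^{1+\beta},\ M_x^{1+\beta}\otimes M_y^{1+\beta}\otimes I_{n_z+1}\big),$$ $$\mathbb{M}_3^{1+\beta}=M_x^{1+\beta}\otimes M_y^{1+\beta}\otimes M_z^{1+\beta},$$ and let $\mathbb{V}_p$ be the diagonal matrix of the sizes $|\sigma^p_i|$. Then $$\mathbb{I}^{\beta}_{p}=\mathbb{B}_p\,\mathbb{M}_p^{1+\beta}\,\mathbb{V}_p^{-1}\in\mathbb{R}^{n_p\times n_p}\quad(p=1,2,3),\qquad \mathbb{I}^{\beta}_{0}=I_{n_0}.$$ *)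

theory Defs
  imports
    "HOL-Analysis.Gamma_Function"
    "Jordan_Normal_Form.Determinant"
    "Jordan_Normal_Form.Gauss_Jordan_Elimination"
begin

(* Matrices, vectors and determinants are those of Jordan_Normal_Form. *)
hide_const (open) Finite_Cartesian_Product.mat Finite_Cartesian_Product.vec
  Finite_Cartesian_Product.row

section \<open>Matrix operations\<close>

definition kron :: "real mat \<Rightarrow> real mat \<Rightarrow> real mat" where
  "kron A B = mat (dim_row A * dim_row B) (dim_col A * dim_col B)
     (\<lambda>(i, j). A $$ (i div dim_row B, j div dim_col B) * B $$ (i mod dim_row B, j mod dim_col B))"

text \<open>Only meaningful for an invertible matrix; an arbitrary value otherwise.\<close>
definition mat_inv :: "real mat \<Rightarrow> real mat" where
  "mat_inv A = the (mat_inverse A)"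

section \<open>The cubical complex\<close>

datatype axis = XX | YY | ZZ

text \<open>Indices are shifted to start at 0: the subdivision points are \<open>s 0 < \<dots> < s m\<close>,
  so there are \<open>m\<close> subintervals.\<close>
definition subdivision :: "real \<Rightarrow> real \<Rightarrow> nat \<Rightarrow> (nat \<Rightarrow> real) \<Rightarrow> bool" where
  "subdivision lo hi m s \<longleftrightarrow> 1 \<le> m \<and> s 0 = lo \<and> s m = hi \<and> (\<forall>i<m. s i < s (Suc i))"

text \<open>A cell is the product over the axes \<open>a\<close> of the interval \<open>[t a (i a), t a (i a + 1)]\<close>
  if \<open>a\<close> occurs in \<open>dirs\<close>, and of the single point \<open>t a (i a)\<close> otherwise, where \<open>i\<close> is \<open>idx\<close>.
  The order of the list \<open>dirs\<close> is the orientation: \<open>[YY, ZZ]\<close> stands for \<open>dy \<and> dz\<close>.\<close>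
datatype cell = Cell (dirs: "axis list") (idx: "axis \<Rightarrow> nat")

text \<open>The oriented cell types of dimension \<open>p\<close>, in block order.  The second face block is the
  \<open>xz\<close> block, whose orientation is \<open>dz \<and> dx\<close>.\<close>
definition cell_types :: "nat \<Rightarrow> axis list list" where
  "cell_types p =
     (if p = 0 then [[]]
      else if p = 1 then [[XX], [YY], [ZZ]]
      else if p = 2 then [[YY, ZZ], [ZZ, XX], [XX, YY]]
      else if p = 3 then [[XX, YY, ZZ]]
      else [])"

definition index_count :: "(axis \<Rightarrow> nat) \<Rightarrow> axis list \<Rightarrow> axis \<Rightarrow> nat" where
  "index_count n T a = (if a \<in> set T then n a else n a + 1)"

definition multi_index :: "nat \<Rightarrow> nat \<Rightarrow> nat \<Rightarrow> axis \<Rightarrow> nat" where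
  "multi_index i j k a = (case a of XX \<Rightarrow> i | YY \<Rightarrow> j | ZZ \<Rightarrow> k)"

definition cells_of_type :: "(axis \<Rightarrow> nat) \<Rightarrow> axis list \<Rightarrow> cell list" where
  "cells_of_type n T =
     [Cell T (multi_index i j k).
        i \<leftarrow> [0..<index_count n T XX], j \<leftarrow> [0..<index_count n T YY], k \<leftarrow> [0..<index_count n T ZZ]]"

definition cells :: "(axis \<Rightarrow> nat) \<Rightarrow> nat \<Rightarrow> cell list" where
  "cells n p = concat (map (cells_of_type n) (cell_types p))"

definition num_cells :: "(axis \<Rightarrow> nat) \<Rightarrow> nat \<Rightarrow> nat" where
  "num_cells n p = length (cells n p)"

section \<open>Geometry of cells\<close>

text \<open>Points of three-dimensional space are functions \<open>axis \<Rightarrow> real\<close>.\<close>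

definition cell_set :: "(axis \<Rightarrow> nat \<Rightarrow> real) \<Rightarrow> cell \<Rightarrow> (axis \<Rightarrow> real) set" where
  "cell_set t \<sigma> =
     {v. \<forall>a. if a \<in> set (dirs \<sigma>) then v a \<in> {t a (idx \<sigma> a)..t a (Suc (idx \<sigma> a))}
             else v a = t a (idx \<sigma> a)}"

text \<open>The boundary relative to the affine hull of the cell.\<close>
definition cell_boundary :: "(axis \<Rightarrow> nat \<Rightarrow> real) \<Rightarrow> cell \<Rightarrow> (axis \<Rightarrow> real) set" where
  "cell_boundary t \<sigma> =
     {v \<in> cell_set t \<sigma>. \<exists>a \<in> set (dirs \<sigma>). v a = t a (idx \<sigma> a) \<or> v a = t a (Suc (idx \<sigma> a))}"

definition cell_size :: "(axis \<Rightarrow> nat \<Rightarrow> real) \<Rightarrow> cell \<Rightarrow> real" where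
  "cell_size t \<sigma> = (\<Prod>a\<in>set (dirs \<sigma>). t a (Suc (idx \<sigma> a)) - t a (idx \<sigma> a))"

section \<open>Orientation and the discrete exterior derivative\<close>

definition unit_vector :: "axis \<Rightarrow> axis \<Rightarrow> real" where
  "unit_vector a b = (if a = b then 1 else 0)"

text \<open>The value of the form \<open>dx\<^sub>a \<and> dx\<^sub>b \<and> \<dots>\<close>, for \<open>T = [a, b, \<dots>]\<close>, on a list of
  \<open>length T\<close> vectors.\<close>
definition wedge :: "axis list \<Rightarrow> (axis \<Rightarrow> real) list \<Rightarrow> real" where
  "wedge T vs = det (mat (length T) (length T) (\<lambda>(r, c). (vs ! c) (T ! r)))"

text \<open>The outward unit normal, inside \<open>\<sigma>\<close>, along a cell \<open>\<tau>\<close> of one dimension less on the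
  boundary of \<open>\<sigma>\<close>.\<close>
definition outward_normal :: "cell \<Rightarrow> cell \<Rightarrow> axis \<Rightarrow> real" where
  "outward_normal \<sigma> \<tau> a =
     (if a \<in> set (dirs \<sigma>) - set (dirs \<tau>)
      then (if idx \<tau> a = Suc (idx \<sigma> a) then 1 else -1) else 0)"

text \<open>Outward normal first: \<open>\<tau>\<close> carries the orientation induced by \<open>\<sigma>\<close> iff the outward normal
  followed by a positively oriented frame of \<open>\<tau>\<close> is a positively oriented frame of \<open>\<sigma>\<close>.  Nodes are
  oriented positively (empty frame).\<close>
definition coherent :: "cell \<Rightarrow> cell \<Rightarrow> bool" where
  "coherent \<sigma> \<tau> \<longleftrightarrow> wedge (dirs \<sigma>) (outward_normal \<sigma> \<tau> # map unit_vector (dirs \<tau>)) > 0"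

definition incidence :: "(axis \<Rightarrow> nat \<Rightarrow> real) \<Rightarrow> cell \<Rightarrow> cell \<Rightarrow> real" where
  "incidence t \<sigma> \<tau> =
     (if cell_set t \<tau> \<subseteq> cell_boundary t \<sigma> then (if coherent \<sigma> \<tau> then 1 else -1) else 0)"

definition ext_deriv :: "(axis \<Rightarrow> nat) \<Rightarrow> (axis \<Rightarrow> nat \<Rightarrow> real) \<Rightarrow> nat \<Rightarrow> real mat" where
  "ext_deriv n t p = mat (num_cells n (p + 1)) (num_cells n p)
     (\<lambda>(i, j). incidence t (cells n (p + 1) ! i) (cells n p ! j))"

section \<open>Generalized incidence\<close>

text \<open>The row of the generalized incidence matrix from nodes to \<open>q\<close>-cells that belongs to a \<open>q\<close>-cell \<open>\<sigma>\<close>, as a function of the node \<open>\<nu>\<close>.  The nodes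
  of the complex contained in \<open>\<sigma>\<close> are exactly its vertices.\<close>
definition gen_incidence :: "(axis \<Rightarrow> nat) \<Rightarrow> (axis \<Rightarrow> nat \<Rightarrow> real) \<Rightarrow> cell \<Rightarrow> cell \<Rightarrow> real" where
  "gen_incidence n t \<sigma> \<nu> =
     (if length (dirs \<sigma>) = 1 then incidence t \<sigma> \<nu>
      else if cell_set t \<nu> \<subseteq> cell_set t \<sigma>
      then \<Prod>e | e \<in> set (cells n 1) \<and> cell_set t e \<subseteq> cell_set t \<sigma> \<and> cell_set t \<nu> \<subseteq> cell_set t e.
             incidence t e \<nu>
      else 0)"

text \<open>The block of rows of the generalized incidence matrix that belongs to the cells of type \<open>T\<close>.\<close>
definition B_block :: "(axis \<Rightarrow> nat) \<Rightarrow> (axis \<Rightarrow> nat \<Rightarrow> real) \<Rightarrow> axis list \<Rightarrow> real mat" where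
  "B_block n t T = mat (length (cells_of_type n T)) (num_cells n 0)
     (\<lambda>(i, j). gen_incidence n t (cells_of_type n T ! i) (cells n 0 ! j))"

definition B_mat :: "(axis \<Rightarrow> nat) \<Rightarrow> (axis \<Rightarrow> nat \<Rightarrow> real) \<Rightarrow> nat \<Rightarrow> real mat" where
  "B_mat n t p = diag_block_mat (map (B_block n t) (cell_types p))"

section \<open>Discrete fractional integrals and fractional derivatives\<close>

text \<open>The matrix \<open>M\<^sup>1\<^sup>+\<^sup>\<beta>\<close> of one subdivision, with indices shifted to start at 0.\<close>
definition M_axis :: "real \<Rightarrow> nat \<Rightarrow> (nat \<Rightarrow> real) \<Rightarrow> real mat" where
  "M_axis \<beta> m s = mat (m + 1) m
     (\<lambda>(i, j). if j < i
               then ((s i - s j) powr (1 + \<beta>) - (s i - s (j + 1)) powr (1 + \<beta>)) / Gamma (2 + \<beta>)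
               else 0)"

definition M_factor ::
    "real \<Rightarrow> (axis \<Rightarrow> nat) \<Rightarrow> (axis \<Rightarrow> nat \<Rightarrow> real) \<Rightarrow> axis list \<Rightarrow> axis \<Rightarrow> real mat" where
  "M_factor \<beta> n t T a = (if a \<in> set T then M_axis \<beta> (n a) (t a) else 1\<^sub>m (n a + 1))"

definition M_mat :: "real \<Rightarrow> (axis \<Rightarrow> nat) \<Rightarrow> (axis \<Rightarrow> nat \<Rightarrow> real) \<Rightarrow> nat \<Rightarrow> real mat" where
  "M_mat \<beta> n t p = diag_block_mat
     (map (\<lambda>T. kron (kron (M_factor \<beta> n t T XX) (M_factor \<beta> n t T YY)) (M_factor \<beta> n t T ZZ))
        (cell_types p))"

definition V_mat :: "(axis \<Rightarrow> nat) \<Rightarrow> (axis \<Rightarrow> nat \<Rightarrow> real) \<Rightarrow> nat \<Rightarrow> real mat" where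
  "V_mat n t p = mat_diag (num_cells n p) (\<lambda>i. cell_size t (cells n p ! i))"

definition frac_int :: "real \<Rightarrow> (axis \<Rightarrow> nat) \<Rightarrow> (axis \<Rightarrow> nat \<Rightarrow> real) \<Rightarrow> nat \<Rightarrow> real mat" where
  "frac_int \<beta> n t p =
     (if p = 0 then 1\<^sub>m (num_cells n 0) else B_mat n t p * M_mat \<beta> n t p * mat_inv (V_mat n t p))"

definition frac_ext_deriv :: "real \<Rightarrow> (axis \<Rightarrow> nat) \<Rightarrow> (axis \<Rightarrow> nat \<Rightarrow> real) \<Rightarrow> nat \<Rightarrow> real mat" where
  "frac_ext_deriv \<alpha> n t p =
     frac_int (1 - \<alpha>) n t (p + 1) * ext_deriv n t p * mat_inv (frac_int (1 - \<alpha>) n t p)"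

end

theory Submission
  imports Defs
begin

text \<open>
  Each operator \<open>D\<^sub>p\<^sup>\<alpha>\<close> is the ordinary discrete exterior derivative conjugated by the fractional
  integrals, so once the fractional integrals are invertible, the inner factors of
  \<open>D\<^sub>p\<^sub>+\<^sub>1\<^sup>\<alpha> D\<^sub>p\<^sup>\<alpha>\<close> cancel and the product contains the factor
  \<open>D\<^sub>p\<^sub>+\<^sub>1 D\<^sub>p = 0\<close> (\<open>mult_interleave\<close>). Two things remain: \<open>D\<^sub>p\<^sub>+\<^sub>1 D\<^sub>p = 0\<close> and the invertibility.

  Both follow from one description of the incidence numbers. A cell is a product of points and
  intervals, one for each axis, and inclusion of cells can be tested axis by axis
  (\<open>cell_subset_iff\<close>). Hence the incidence number of two cells is a product of one-dimensional
  incidence numbers or Kronecker deltas, times a sign that depends only on the two cell types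
  (\<open>incidence_eq\<close>); for generalized incidence the same holds without the sign
  (\<open>gen_incidence_eq\<close>).

  For \<open>D\<^sub>p\<^sub>+\<^sub>1 D\<^sub>p = 0\<close> (\<open>ext_deriv_ext_deriv\<close>), sum over the intermediate cells of one type.
  The sum factors over the axes, and its value does not depend on the intermediate type
  (\<open>coord_inc_comp\<close>), except for the product of the two signs. There are two intermediate types,
  given by the two orders in which the two axes can be dropped, and their signs are opposite
  (\<open>sum_facet_sign_eq_0\<close>).

  For the invertibility, the rows of the generalized incidence matrix that belong to one cell type
  form a Kronecker product over the axes (\<open>B_block_eq_kron\<close>), as does the corresponding block of
  the matrix \<open>M\<^sup>1\<^sup>+\<^sup>\<beta>\<close>. By the mixed product rule \<open>kron_mult\<close>, their product is a Kronecker product of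
  identity matrices and of the matrices \<open>D M\<^sup>1\<^sup>+\<^sup>\<beta>\<close> of single subdivisions, and the latter are
  lower triangular with nonzero diagonal (\<open>invertible_D_axis_M_axis\<close>).
\<close>

section \<open>Invertible matrices\<close>

lemma invertible_matI:
  fixes A :: "'a :: field mat"
  assumes "A \<in> carrier_mat n n" "B \<in> carrier_mat n n" "A * B = 1\<^sub>m n"
  shows "invertible_mat A"
proof -
  have "B * A = 1\<^sub>m n" using mat_mult_left_right_inverse[OF assms] .
  then show ?thesis using assms
    unfolding invertible_mat_def inverts_mat_def by (auto simp: square_mat.simps)
qed

lemma invertible_matE:
  fixes A :: "'a :: field mat"
  assumes "invertible_mat A" "A \<in> carrier_mat n n"
  obtains B where "B \<in> carrier_mat n n" "A * B = 1\<^sub>m n" "B * A = 1\<^sub>m n"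
proof -
  obtain B where B: "A * B = 1\<^sub>m (dim_row A)" "B * A = 1\<^sub>m (dim_row B)"
    using assms(1) unfolding invertible_mat_def inverts_mat_def by blast
  have "dim_col B = n" using arg_cong[OF B(1), of dim_col] assms(2) by simp
  moreover have "dim_row B = n" using arg_cong[OF B(2), of dim_col] assms(2) by simp
  ultimately show ?thesis using that[of B] B assms(2) by auto
qed

lemma invertible_mat_mult:
  fixes A B :: "'a :: field mat"
  assumes "invertible_mat A" "A \<in> carrier_mat n n" "invertible_mat B" "B \<in> carrier_mat n n"
  shows "invertible_mat (A * B)"
proof -
  obtain A' where A': "A' \<in> carrier_mat n n" "A * A' = 1\<^sub>m n"
    using assms invertible_matE by metis
  obtain B' where B': "B' \<in> carrier_mat n n" "B * B' = 1\<^sub>m n"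
    using assms invertible_matE by metis
  have "A * B * (B' * A') = A * (B * (B' * A'))"
    by (rule assoc_mult_mat) (use assms A' B' in auto)
  also have "B * (B' * A') = (B * B') * A'"
    by (rule assoc_mult_mat[symmetric]) (use assms A' B' in auto)
  finally have "A * B * (B' * A') = 1\<^sub>m n" using A' B' by simp
  then show ?thesis using assms A' B' by (intro invertible_matI[of _ n "B' * A'"]) auto
qed

lemma mat_inv:
  assumes "invertible_mat A" "A \<in> carrier_mat n n"
  shows "mat_inv A \<in> carrier_mat n n" "A * mat_inv A = 1\<^sub>m n" "mat_inv A * A = 1\<^sub>m n"
proof -
  obtain B where B: "B \<in> carrier_mat n n" "A * B = 1\<^sub>m n" "B * A = 1\<^sub>m n"
    using invertible_matE[OF assms] .
  then have "A \<in> Units (ring_mat TYPE(real) n ())"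
    using assms(2) by (auto simp: Units_def ring_mat_def)
  then obtain C where "mat_inverse A = Some C"
    using mat_inverse(1)[OF assms(2), of "()"] by (cases "mat_inverse A") auto
  with mat_inverse(2)[OF assms(2) this]
  show "mat_inv A \<in> carrier_mat n n" "A * mat_inv A = 1\<^sub>m n" "mat_inv A * A = 1\<^sub>m n"
    by (simp_all add: mat_inv_def)
qed

lemma invertible_mat_inv:
  assumes "invertible_mat A" "A \<in> carrier_mat n n"
  shows "invertible_mat (mat_inv A)"
  using mat_inv[OF assms] assms(2) by (intro invertible_matI[of _ n A]) auto

lemma invertible_one_mat: "invertible_mat (1\<^sub>m n :: 'a :: field mat)"
  by (rule invertible_matI[of _ n "1\<^sub>m n"]) auto

lemma invertible_mat_if_det:
  fixes A :: "'a :: field mat"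
  assumes "A \<in> carrier_mat n n" "det A \<noteq> 0"
  shows "invertible_mat A"
  using det_non_zero_imp_unit[OF assms, of "()"] assms(1)
  by (auto simp: Units_def ring_mat_def intro: invertible_matI)

lemma mult_interleave:
  fixes A B C D :: "'a :: field mat"
  assumes c: "A \<in> carrier_mat n4 n3" "B \<in> carrier_mat n3 n2" "C \<in> carrier_mat n2 n2"
    "C' \<in> carrier_mat n2 n2" "D \<in> carrier_mat n2 n1" "E \<in> carrier_mat n1 n1"
    and inv: "C' * C = 1\<^sub>m n2" and zero: "B * D = 0\<^sub>m n3 n1"
  shows "(A * B * C') * (C * D * E) = 0\<^sub>m n4 n1"
proof -
  have "(A * B * C') * (C * D * E) = A * B * (C' * (C * D * E))"
    using c by (intro assoc_mult_mat) auto
  also have "C' * (C * D * E) = C' * (C * (D * E))"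
    using c by (subst assoc_mult_mat[of C n2 n2 D n1 E n1]) auto
  also have "\<dots> = C' * C * (D * E)"
    using c by (intro assoc_mult_mat[symmetric]) auto
  also have "\<dots> = D * E"
    unfolding inv using c by (intro left_mult_one_mat) auto
  also have "A * B * (D * E) = A * (B * (D * E))"
    using c by (intro assoc_mult_mat) auto
  also have "B * (D * E) = B * D * E"
    using c by (intro assoc_mult_mat[symmetric]) auto
  also have "\<dots> = 0\<^sub>m n3 n1"
    unfolding zero using c by simp
  also have "A * 0\<^sub>m n3 n1 = 0\<^sub>m n4 n1"
    using c by simp
  finally show ?thesis .
qed

section \<open>Block diagonal matrices\<close>

lemma four_block_diag_mult:
  fixes A B C D :: "'a :: semiring_0 mat"
  assumes [simp]: "dim_row B = dim_col A" "dim_row D = dim_col C"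
  shows "four_block_mat A (0\<^sub>m (dim_row A) (dim_col C)) (0\<^sub>m (dim_row C) (dim_col A)) C
        * four_block_mat B (0\<^sub>m (dim_row B) (dim_col D)) (0\<^sub>m (dim_row D) (dim_col B)) D
      = four_block_mat (A * B) (0\<^sub>m (dim_row A) (dim_col D)) (0\<^sub>m (dim_row C) (dim_col B)) (C * D)"
  apply (subst mult_four_block_mat[of _ "dim_row A" "dim_col A" _ "dim_col C" _ "dim_row C"
          _ _ "dim_col B" _ "dim_col D"])
  apply (auto)[8]
  apply (rule arg_cong4[where f=four_block_mat])
  apply auto
  done

lemma diag_block_mat_mult:
  fixes f g :: "'b \<Rightarrow> 'a :: semiring_0 mat"
  assumes "\<And>x. x \<in> set xs \<Longrightarrow> dim_col (f x) = dim_row (g x)"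
  shows "diag_block_mat (map f xs) * diag_block_mat (map g xs)
       = diag_block_mat (map (\<lambda>x. f x * g x) xs)"
  using assms
proof (induction xs)
  case (Cons x xs)
  let ?F = "diag_block_mat (map f xs)" and ?G = "diag_block_mat (map g xs)"
  have col: "dim_col (f x) = dim_row (g x)" "dim_col ?F = dim_row ?G"
    using Cons.prems by (simp_all add: dim_diag_block_mat comp_def cong: map_cong)
  show ?case
    using four_block_diag_mult[OF col[symmetric]] Cons
    by (simp only: list.map diag_block_mat.simps Let_def list.set_intros index_mult_mat
        dim_diag_block_mat map_map comp_def)
qed simp

lemma diag_block_mat_one:
  "diag_block_mat (map (\<lambda>x. 1\<^sub>m (d x)) xs) = 1\<^sub>m (sum_list (map d xs))"
  by (induction xs) (auto simp: Let_def)

lemma diag_block_mat_carrier: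
  assumes "\<And>x. x \<in> set xs \<Longrightarrow> f x \<in> carrier_mat (r x) (c x)"
  shows "diag_block_mat (map f xs) \<in> carrier_mat (sum_list (map r xs)) (sum_list (map c xs))"
  using assms by (induction xs) (auto simp: Let_def)

lemma invertible_diag_block_mat:
  fixes f :: "'b \<Rightarrow> 'a :: field mat"
  assumes "\<And>x. x \<in> set xs \<Longrightarrow> f x \<in> carrier_mat (d x) (d x)"
    and "\<And>x. x \<in> set xs \<Longrightarrow> invertible_mat (f x)"
  shows "invertible_mat (diag_block_mat (map f xs))"
proof -
  have "\<exists>B. B \<in> carrier_mat (d x) (d x) \<and> f x * B = 1\<^sub>m (d x)" if "x \<in> set xs" for x
    using assms[OF that] invertible_matE by metis
  then obtain g where g: "g x \<in> carrier_mat (d x) (d x)" "f x * g x = 1\<^sub>m (d x)"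
    if "x \<in> set xs" for x by metis
  let ?n = "sum_list (map d xs)"
  have "diag_block_mat (map f xs) * diag_block_mat (map g xs)
      = diag_block_mat (map (\<lambda>x. f x * g x) xs)"
    by (rule diag_block_mat_mult) (metis assms(1) g(1) carrier_matD)
  also have "map (\<lambda>x. f x * g x) xs = map (\<lambda>x. 1\<^sub>m (d x)) xs"
    using g(2) by simp
  finally show ?thesis
    using assms(1) g(1)
    by (intro invertible_matI[of _ ?n "diag_block_mat (map g xs)"] diag_block_mat_carrier)
       (auto simp: diag_block_mat_one)
qed

section \<open>Kronecker products\<close>

lemma dim_kron[simp]:
  "dim_row (kron A B) = dim_row A * dim_row B" "dim_col (kron A B) = dim_col A * dim_col B"
  by (simp_all add: kron_def)

lemma kron_carrier:
  "A \<in> carrier_mat r c \<Longrightarrow> B \<in> carrier_mat r' c' \<Longrightarrow> kron A B \<in> carrier_mat (r * r') (c * c')"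
  by (intro carrier_matI) simp_all

lemma div_mod_bounds:
  fixes i m n :: nat
  assumes "i < m * n"
  shows "i div n < m" "i mod n < n"
proof -
  show "i div n < m" using assms by (rule less_mult_imp_div_less)
  have "n \<noteq> 0" using assms by (metis mult_0_right not_less_zero)
  then show "i mod n < n" by simp
qed

lemma sum_div_mod:
  fixes f :: "nat \<Rightarrow> nat \<Rightarrow> 'a :: comm_monoid_add"
  shows "(\<Sum>k<m * n. f (k div n) (k mod n)) = (\<Sum>i<m. \<Sum>j<n. f i j)"
proof -
  have "(\<Sum>k<m * n. f (k div n) (k mod n)) = (\<Sum>i<m. \<Sum>k\<in>{i * n..<i * n + n}. f (k div n) (k mod n))"
    by (rule sum.nat_group[symmetric])
  also have "\<dots> = (\<Sum>i<m. \<Sum>j<n. f i j)"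
  proof (rule sum.cong)
    fix i
    have "(\<Sum>k\<in>{i * n..<i * n + n}. f (k div n) (k mod n))
        = (\<Sum>j\<in>{0..<n}. f ((j + i * n) div n) ((j + i * n) mod n))"
      using sum.shift_bounds_nat_ivl[of "\<lambda>k. f (k div n) (k mod n)" 0 "i * n" n]
      by (simp add: add.commute)
    also have "\<dots> = (\<Sum>j<n. f i j)"
      by (rule sum.cong) auto
    finally show "(\<Sum>k\<in>{i * n..<i * n + n}. f (k div n) (k mod n)) = (\<Sum>j<n. f i j)" .
  qed simp
  finally show ?thesis .
qed

lemma kron_mult:
  assumes "dim_col A = dim_row C" "dim_col B = dim_row D"
  shows "kron A B * kron C D = kron (A * C) (B * D)"
proof (rule eq_matI)
  fix i j
  assume "i < dim_row (kron (A * C) (B * D))" "j < dim_col (kron (A * C) (B * D))"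
  then have ij: "i < dim_row A * dim_row B" "j < dim_col C * dim_col D" by auto
  note b = div_mod_bounds[OF ij(1)] div_mod_bounds[OF ij(2)]
  let ?a = "\<lambda>k. A $$ (i div dim_row B, k) * C $$ (k, j div dim_col D)"
  let ?b = "\<lambda>k. B $$ (i mod dim_row B, k) * D $$ (k, j mod dim_col D)"
  have "(kron A B * kron C D) $$ (i, j)
      = (\<Sum>k<dim_row C * dim_row D. ?a (k div dim_row D) * ?b (k mod dim_row D))"
    using ij assms
    by (auto simp: scalar_prod_def kron_def atLeast0LessThan intro!: sum.cong)
  also have "\<dots> = (\<Sum>k<dim_row C. \<Sum>l<dim_row D. ?a k * ?b l)"
    by (rule sum_div_mod)
  also have "\<dots> = (\<Sum>k<dim_row C. ?a k) * (\<Sum>l<dim_row D. ?b l)"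
    by (simp add: sum_product)
  also have "\<dots> = kron (A * C) (B * D) $$ (i, j)"
    using ij b assms by (simp add: kron_def scalar_prod_def atLeast0LessThan)
  finally show "(kron A B * kron C D) $$ (i, j) = kron (A * C) (B * D) $$ (i, j)" .
qed auto

lemma kron_one: "kron (1\<^sub>m m) (1\<^sub>m n) = 1\<^sub>m (m * n)"
proof (rule eq_matI)
  fix i j assume "i < dim_row (1\<^sub>m (m * n) :: real mat)" "j < dim_col (1\<^sub>m (m * n) :: real mat)"
  then have ij: "i < m * n" "j < m * n" by auto
  have "i = j \<longleftrightarrow> i div n = j div n \<and> i mod n = j mod n"
    by (metis div_mult_mod_eq)
  then show "kron (1\<^sub>m m) (1\<^sub>m n) $$ (i, j) = 1\<^sub>m (m * n) $$ (i, j)"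
    using ij div_mod_bounds[OF ij(1)] div_mod_bounds[OF ij(2)] by (auto simp: kron_def)
qed auto

lemma invertible_kron:
  assumes "invertible_mat A" "A \<in> carrier_mat m m" "invertible_mat B" "B \<in> carrier_mat n n"
  shows "invertible_mat (kron A B)"
proof -
  obtain A' where A': "A' \<in> carrier_mat m m" "A * A' = 1\<^sub>m m"
    using invertible_matE[OF assms(1,2)] .
  obtain B' where B': "B' \<in> carrier_mat n n" "B * B' = 1\<^sub>m n"
    using invertible_matE[OF assms(3,4)] .
  have "kron A B * kron A' B' = 1\<^sub>m (m * n)"
    using kron_mult[of A A' B B'] assms A' B' by (auto simp: kron_one)
  then show ?thesis
    using assms A' B' kron_carrier by (intro invertible_matI[of _ "m * n" "kron A' B'"]) auto
qed

section \<open>Enumeration of the cells\<close>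

lemma UNIV_axis: "(UNIV :: axis set) = {XX, YY, ZZ}"
  using axis.exhaust by auto

instance axis :: finite
  by standard (simp add: UNIV_axis)

lemma all_axis: "(\<forall>a. P a) \<longleftrightarrow> P XX \<and> P YY \<and> P ZZ"
  by (metis axis.exhaust)

lemma prod_axis: "(\<Prod>a\<in>UNIV. f a) = f XX * f YY * (f ZZ :: 'a :: comm_monoid_mult)"
  by (simp add: UNIV_axis mult.assoc)

lemma multi_index_simps[simp]:
  "multi_index i j k XX = i" "multi_index i j k YY = j" "multi_index i j k ZZ = k"
  by (simp_all add: multi_index_def)

text \<open>The lexicographic enumeration of index triples.\<close>
lemma nested_map_eq_product:
  fixes f :: "'a \<Rightarrow> 'b \<Rightarrow> 'c \<Rightarrow> 'd"
  shows "concat (map (\<lambda>i. concat (map (\<lambda>j. map (f i j) zs) ys)) xs)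
   = map (\<lambda>((i, j), k). f i j k) (List.product (List.product xs ys) zs)"
proof -
  have app: "List.product (us @ vs) zs = List.product us zs @ List.product vs zs"
    for us vs :: "('a \<times> 'b) list"
    by (induction us) simp_all
  have one: "concat (map (\<lambda>j. map (f i j) zs) ys)
     = map (\<lambda>((i, j), k). f i j k) (List.product (map (Pair i) ys) zs)" for i
    by (induction ys) simp_all
  show ?thesis
    by (induction xs) (simp_all add: app one)
qed

lemma cells_of_type_product:
  "cells_of_type n T = map (\<lambda>((i, j), k). Cell T (multi_index i j k))
     (List.product (List.product [0..<index_count n T XX] [0..<index_count n T YY])
        [0..<index_count n T ZZ])"
  unfolding cells_of_type_def by (rule nested_map_eq_product)

text \<open>The index ranges of the cells of type \<open>T\<close>.\<close>
definition admissible :: "(axis \<Rightarrow> nat) \<Rightarrow> axis list \<Rightarrow> (axis \<Rightarrow> nat) \<Rightarrow> bool" where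
  "admissible n T i \<longleftrightarrow> (\<forall>a. i a < index_count n T a)"

lemma set_cells_of_type: "set (cells_of_type n T) = Cell T ` {i. admissible n T i}"
proof
  show "set (cells_of_type n T) \<subseteq> Cell T ` {i. admissible n T i}"
    by (auto simp: cells_of_type_def admissible_def all_axis)
  show "Cell T ` {i. admissible n T i} \<subseteq> set (cells_of_type n T)"
  proof clarify
    fix i assume i: "admissible n T i"
    have "i = multi_index (i XX) (i YY) (i ZZ)"
      by (simp add: fun_eq_iff all_axis)
    moreover have "Cell T (multi_index x y z) \<in> set (cells_of_type n T)"
      if "x < index_count n T XX" "y < index_count n T YY" "z < index_count n T ZZ" for x y z
      unfolding cells_of_type_product set_map
      by (rule image_eqI[of _ _ "((x, y), z)"]) (use that in auto)
    ultimately show "Cell T i \<in> set (cells_of_type n T)"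
      using i unfolding admissible_def by metis
  qed
qed

lemma set_cells: "set (cells n p) = {Cell T i |T i. T \<in> set (cell_types p) \<and> admissible n T i}"
  by (auto simp: cells_def set_cells_of_type)

lemma length_cells_of_type:
  "length (cells_of_type n T) = index_count n T XX * index_count n T YY * index_count n T ZZ"
  by (simp add: cells_of_type_product)

lemma num_cells_eq_sum: "num_cells n p = sum_list (map (\<lambda>T. length (cells_of_type n T)) (cell_types p))"
  by (simp add: num_cells_def cells_def length_concat comp_def)

lemma nth_cells_of_type:
  assumes "r < index_count n T XX * index_count n T YY * index_count n T ZZ"
  shows "cells_of_type n T ! r = Cell T (multi_index
           (r div index_count n T ZZ div index_count n T YY)
           (r div index_count n T ZZ mod index_count n T YY)
           (r mod index_count n T ZZ))"
proof -
  note b = div_mod_bounds[OF assms]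
  note b' = div_mod_bounds[OF b(1)]
  show ?thesis
    using assms b b' by (simp add: cells_of_type_product product_nth)
qed

lemma sum_list_cells_of_type:
  fixes f :: "cell \<Rightarrow> 'a :: comm_monoid_add"
  shows "sum_list (map f (cells_of_type n T)) =
    (\<Sum>i<index_count n T XX. \<Sum>j<index_count n T YY. \<Sum>k<index_count n T ZZ.
       f (Cell T (multi_index i j k)))"
proof -
  have conc: "sum_list (concat xss) = sum_list (map sum_list xss)" for xss :: "'a list list"
    by (induction xss) simp_all
  show ?thesis
    by (simp add: cells_of_type_def map_concat conc comp_def interv_sum_list_conv_sum_set_nat
        atLeast0LessThan)
qed

text \<open>A sum over the cells of one type factors over the axes.\<close>
lemma sum_list_cells_of_type_prod:
  fixes g :: "axis \<Rightarrow> nat \<Rightarrow> real"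
  shows "sum_list (map (\<lambda>\<tau>. \<Prod>a\<in>UNIV. g a (idx \<tau> a)) (cells_of_type n T))
       = (\<Prod>a\<in>UNIV. \<Sum>y<index_count n T a. g a y)"
  by (simp add: sum_list_cells_of_type prod_axis mult.assoc
      flip: sum_distrib_left sum_distrib_right)

section \<open>Incidence and fractional integration on one axis\<close>

text \<open>The factor that one axis contributes to the incidence number of a cell of type \<open>T\<close> and a
  cell of type \<open>T'\<close> with indices \<open>x\<close> and \<open>y\<close> on that axis: the signed incidence of an interval
  and an endpoint if the axis is lost from \<open>T\<close> to \<open>T'\<close>, and equality of the indices otherwise.\<close>
definition coord_inc :: "axis list \<Rightarrow> axis list \<Rightarrow> axis \<Rightarrow> nat \<Rightarrow> nat \<Rightarrow> real" where
  "coord_inc T T' a x y =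
     (if a \<in> set T - set T' then of_bool (y = Suc x) - of_bool (y = x) else of_bool (y = x))"

text \<open>If \<open>a\<close> is lost in one of the two steps, the other step is an equality of indices; the
  intermediate type thus has no influence on the result.\<close>
lemma coord_inc_comp:
  assumes "set T'' \<subseteq> set T'" "set T' \<subseteq> set T"
    and "x < index_count n T a" "z < index_count n T'' a"
  shows "(\<Sum>y<index_count n T' a. coord_inc T T' a x y * coord_inc T' T'' a y z)
       = coord_inc T T'' a x z"
proof -
  have l: "(\<Sum>y<m. of_bool (y = x) * h y) = h x" if "x < m" for m and h :: "nat \<Rightarrow> real"
    using that by (simp add: of_bool_def if_distrib[of "\<lambda>c. c * _"] cong: if_cong)
  have r: "(\<Sum>y<m. h y * of_bool (z = y)) = h z" if "z < m" for m and h :: "nat \<Rightarrow> real"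
    using that by (simp add: of_bool_def if_distrib[of "\<lambda>c. _ * c"] cong: if_cong)
  consider "a \<in> set T'" | "a \<notin> set T'" by blast
  then show ?thesis
  proof cases
    case 1
    then have "a \<in> set T" using assms by auto
    with 1 have "(\<Sum>y<index_count n T' a. coord_inc T T' a x y * coord_inc T' T'' a y z)
        = (\<Sum>y<index_count n T' a. of_bool (y = x) * coord_inc T' T'' a y z)"
      by (simp add: coord_inc_def)
    also have "\<dots> = coord_inc T' T'' a x z"
      using assms 1 \<open>a \<in> set T\<close> by (intro l) (simp add: index_count_def)
    also have "\<dots> = coord_inc T T'' a x z"
      using 1 \<open>a \<in> set T\<close> by (simp add: coord_inc_def)
    finally show ?thesis .
  next
    case 2
    then have "a \<notin> set T''" using assms by auto
    with 2 have "(\<Sum>y<index_count n T' a. coord_inc T T' a x y * coord_inc T' T'' a y z)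
        = (\<Sum>y<index_count n T' a. coord_inc T T' a x y * of_bool (z = y))"
      by (simp add: coord_inc_def)
    also have "\<dots> = coord_inc T T' a x z"
      using assms 2 \<open>a \<notin> set T''\<close> by (intro r) (simp add: index_count_def)
    also have "\<dots> = coord_inc T T'' a x z"
      using 2 \<open>a \<notin> set T''\<close> by (simp add: coord_inc_def)
    finally show ?thesis .
  qed
qed

lemma subdivision_less:
  assumes "subdivision lo hi m s" "i < j" "j \<le> m"
  shows "s i < s j"
  using assms(2,3)
proof (induction j)
  case (Suc j)
  have "s j < s (Suc j)" using assms(1) Suc.prems by (simp add: subdivision_def)
  then show ?case using Suc by (cases "i = j") auto
qed simp

lemma subdivision_le_iff:
  assumes "subdivision lo hi m s" "i \<le> m" "j \<le> m"
  shows "s i \<le> s j \<longleftrightarrow> i \<le> j"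
proof (cases i j rule: linorder_cases)
  case less
  then show ?thesis using subdivision_less[OF assms(1) less assms(3)] by simp
next
  case greater
  then show ?thesis using subdivision_less[OF assms(1) greater assms(2)] by simp
qed simp

text \<open>The signed incidence matrix of a subdivision with \<open>m\<close> intervals.\<close>
definition D_axis :: "nat \<Rightarrow> real mat" where
  "D_axis m = mat m (m + 1) (\<lambda>(i, j). of_bool (j = Suc i) - of_bool (j = i))"

lemma D_axis_mult:
  assumes "M \<in> carrier_mat (m + 1) k" "i < m" "j < k"
  shows "(D_axis m * M) $$ (i, j) = M $$ (Suc i, j) - M $$ (i, j)"
proof -
  have "(D_axis m * M) $$ (i, j)
      = (\<Sum>l<m + 1. (of_bool (l = Suc i) - of_bool (l = i)) * M $$ (l, j))"
    using assms by (simp add: D_axis_def scalar_prod_def atLeast0LessThan)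
  also have "\<dots> = (\<Sum>l<m + 1. (if l = Suc i then M $$ (l, j) else 0))
                 - (\<Sum>l<m + 1. (if l = i then M $$ (l, j) else 0))"
    by (subst sum_subtractf[symmetric]) (intro sum.cong, auto)
  also have "\<dots> = M $$ (Suc i, j) - M $$ (i, j)"
    using assms by (simp add: sum.delta)
  finally show ?thesis .
qed

text \<open>\<open>D_axis m * M_axis \<beta> m s\<close> is lower triangular, with the entries
  \<open>(s (i + 1) - s i) powr (1 + \<beta>) / Gamma (2 + \<beta>)\<close> on the diagonal.\<close>
lemma invertible_D_axis_M_axis:
  assumes "subdivision lo hi m s" "0 < \<beta>"
  shows "invertible_mat (D_axis m * M_axis \<beta> m s)"
proof -
  have M: "M_axis \<beta> m s \<in> carrier_mat (m + 1) m" by (simp add: M_axis_def)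
  let ?A = "D_axis m * M_axis \<beta> m s"
  have A: "?A \<in> carrier_mat m m" by (intro carrier_matI) (simp_all add: D_axis_def M_axis_def)
  have low: "?A $$ (i, j) = 0" if "i < j" "j < m" for i j
    using that D_axis_mult[OF M, of i j] by (simp add: M_axis_def)
  have diag: "?A $$ (i, i) \<noteq> 0" if i: "i < m" for i
  proof -
    have "s i < s (Suc i)" using assms(1) i by (simp add: subdivision_def)
    moreover have "Gamma (2 + \<beta>) > 0" using assms(2) by (intro Gamma_real_pos) simp
    ultimately show ?thesis
      using i D_axis_mult[OF M i i] by (simp add: M_axis_def)
  qed
  have "det ?A \<noteq> 0"
    using diag A by (auto simp: det_lower_triangular[OF low A] diag_mat_def prod_list_zero_iff)
  then show ?thesis using A invertible_mat_if_det by blast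
qed

section \<open>Orientation signs\<close>

lemma det_dim_2:
  fixes A :: "'a :: comm_ring_1 mat"
  assumes "A \<in> carrier_mat 2 2"
  shows "det A = A $$ (0, 0) * A $$ (1, 1) - A $$ (1, 0) * A $$ (0, 1)"
  using laplace_expansion_column[OF assms, of 0] assms
  by (simp add: cofactor_def det_single mat_delete_def numeral_2_eq_2)

lemma det_dim_3:
  fixes A :: "'a :: comm_ring_1 mat"
  assumes "A \<in> carrier_mat 3 3"
  shows "det A = A $$ (0, 0) * (A $$ (1, 1) * A $$ (2, 2) - A $$ (2, 1) * A $$ (1, 2))
               - A $$ (1, 0) * (A $$ (0, 1) * A $$ (2, 2) - A $$ (2, 1) * A $$ (0, 2))
               + A $$ (2, 0) * (A $$ (0, 1) * A $$ (1, 2) - A $$ (1, 1) * A $$ (0, 2))"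
proof -
  have minor: "det (mat_delete A i 0) = mat_delete A i 0 $$ (0, 0) * mat_delete A i 0 $$ (1, 1)
         - mat_delete A i 0 $$ (1, 0) * mat_delete A i 0 $$ (0, 1)" if "i < 3" for i
    using assms that by (intro det_dim_2 carrier_matI) simp_all
  have "det A = A $$ (0, 0) * det (mat_delete A 0 0) - A $$ (1, 0) * det (mat_delete A 1 0)
              + A $$ (2, 0) * det (mat_delete A 2 0)"
    using laplace_expansion_column[OF assms, of 0]
    by (simp add: cofactor_def numeral_2_eq_2 numeral_3_eq_3)
  then have "det A =
      A $$ (0, 0) * (mat_delete A 0 0 $$ (0, 0) * mat_delete A 0 0 $$ (1, 1)
                   - mat_delete A 0 0 $$ (1, 0) * mat_delete A 0 0 $$ (0, 1))
    - A $$ (1, 0) * (mat_delete A 1 0 $$ (0, 0) * mat_delete A 1 0 $$ (1, 1)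
                   - mat_delete A 1 0 $$ (1, 0) * mat_delete A 1 0 $$ (0, 1))
    + A $$ (2, 0) * (mat_delete A 2 0 $$ (0, 0) * mat_delete A 2 0 $$ (1, 1)
                   - mat_delete A 2 0 $$ (1, 0) * mat_delete A 2 0 $$ (0, 1))"
    by (simp add: minor)
  then show ?thesis
    using assms by (simp add: mat_delete_def numeral_2_eq_2[symmetric])
qed

lemma wedge_1: "wedge [a] [u] = u a"
  by (simp add: wedge_def det_single)

lemma wedge_2: "wedge [a, b] [u, v] = u a * v b - u b * v a"
  unfolding wedge_def by (subst det_dim_2) (simp_all add: numeral_2_eq_2)

lemma wedge_3:
  "wedge [a, b, c] [u, v, w] =
     u a * (v b * w c - v c * w b) - u b * (v a * w c - v c * w a) + u c * (v a * w b - v b * w a)"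
  unfolding wedge_def by (subst det_dim_3) (simp_all add: numeral_2_eq_2 numeral_3_eq_3)

text \<open>For \<open>T'\<close> obtained from \<open>T\<close> by dropping one axis \<open>a\<close>, the sign of the frame \<open>a # T'\<close> with
  respect to \<open>T\<close>; this is the incidence number of a cell of type \<open>T\<close> and its facet of type \<open>T'\<close>
  of larger \<open>a\<close>-coordinate. The value is \<open>0\<close> if \<open>T'\<close> has an axis outside \<open>T\<close>.\<close>
definition facet_sign :: "axis list \<Rightarrow> axis list \<Rightarrow> real" where
  "facet_sign T T' =
     (if set T' \<subseteq> set T
      then wedge T (map unit_vector (filter (\<lambda>a. a \<notin> set T') T @ T')) else 0)"

lemma facet_sign_values:
  "facet_sign [XX] [] = 1"
  "facet_sign [YY] [] = 1"
  "facet_sign [ZZ] [] = 1"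
  "facet_sign [YY, ZZ] [XX] = 0"
  "facet_sign [YY, ZZ] [YY] = -1"
  "facet_sign [YY, ZZ] [ZZ] = 1"
  "facet_sign [ZZ, XX] [XX] = 1"
  "facet_sign [ZZ, XX] [YY] = 0"
  "facet_sign [ZZ, XX] [ZZ] = -1"
  "facet_sign [XX, YY] [XX] = -1"
  "facet_sign [XX, YY] [YY] = 1"
  "facet_sign [XX, YY] [ZZ] = 0"
  "facet_sign [XX, YY, ZZ] [YY, ZZ] = 1"
  "facet_sign [XX, YY, ZZ] [ZZ, XX] = 1"
  "facet_sign [XX, YY, ZZ] [XX, YY] = 1"
  by (simp_all add: facet_sign_def wedge_1 wedge_2 wedge_3 unit_vector_def)

lemma coherent_values:
  "coherent (Cell [XX] i) (Cell [] i') \<longleftrightarrow> i' XX = Suc (i XX)"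
  "coherent (Cell [YY] i) (Cell [] i') \<longleftrightarrow> i' YY = Suc (i YY)"
  "coherent (Cell [ZZ] i) (Cell [] i') \<longleftrightarrow> i' ZZ = Suc (i ZZ)"
  "coherent (Cell [YY, ZZ] i) (Cell [YY] i') \<longleftrightarrow> i' ZZ \<noteq> Suc (i ZZ)"
  "coherent (Cell [YY, ZZ] i) (Cell [ZZ] i') \<longleftrightarrow> i' YY = Suc (i YY)"
  "coherent (Cell [ZZ, XX] i) (Cell [XX] i') \<longleftrightarrow> i' ZZ = Suc (i ZZ)"
  "coherent (Cell [ZZ, XX] i) (Cell [ZZ] i') \<longleftrightarrow> i' XX \<noteq> Suc (i XX)"
  "coherent (Cell [XX, YY] i) (Cell [XX] i') \<longleftrightarrow> i' YY \<noteq> Suc (i YY)"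
  "coherent (Cell [XX, YY] i) (Cell [YY] i') \<longleftrightarrow> i' XX = Suc (i XX)"
  "coherent (Cell [XX, YY, ZZ] i) (Cell [YY, ZZ] i') \<longleftrightarrow> i' XX = Suc (i XX)"
  "coherent (Cell [XX, YY, ZZ] i) (Cell [ZZ, XX] i') \<longleftrightarrow> i' YY = Suc (i YY)"
  "coherent (Cell [XX, YY, ZZ] i) (Cell [XX, YY] i') \<longleftrightarrow> i' ZZ = Suc (i ZZ)"
  by (simp_all add: coherent_def outward_normal_def wedge_1 wedge_2 wedge_3 unit_vector_def)

lemma cell_types_cases:
  assumes "T \<in> set (cell_types (Suc p))" "T' \<in> set (cell_types p)"
  obtains
    (0) a where "p = 0" "T = [a]" "T' = []"
  | (1) a where "p = 1" "T \<in> {[YY, ZZ], [ZZ, XX], [XX, YY]}" "T' = [a]"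
  | (2) "p = 2" "T = [XX, YY, ZZ]" "T' \<in> {[YY, ZZ], [ZZ, XX], [XX, YY]}"
  using assms by (auto simp: cell_types_def split: if_splits)

text \<open>If \<open>T''\<close> is obtained from \<open>T\<close> by dropping two axes, the two orders of dropping them have opposite
  signs; otherwise every term vanishes.\<close>
lemma sum_facet_sign_eq_0:
  assumes "T \<in> set (cell_types (Suc (Suc p)))" "T'' \<in> set (cell_types p)"
  shows "sum_list (map (\<lambda>T'. facet_sign T T' * facet_sign T' T'') (cell_types (Suc p))) = 0"
proof -
  consider "p = 0" | "p = 1"
    using assms by (force simp: cell_types_def split: if_splits)
  then show ?thesis
    by cases (use assms in \<open>auto simp: cell_types_def facet_sign_values\<close>)
qed

section \<open>Incidence numbers as products over the axes\<close>

lemma Pi_UNIV_subset_iff: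
  assumes "\<And>a. A a \<noteq> {}"
  shows "Pi UNIV A \<subseteq> Pi UNIV B \<longleftrightarrow> (\<forall>a. A a \<subseteq> B a)"
proof (intro iffI allI subsetI)
  fix a x
  assume sub: "Pi UNIV A \<subseteq> Pi UNIV B" and x: "x \<in> A a"
  have "\<forall>a. \<exists>y. y \<in> A a" using assms by blast
  then obtain v where "\<And>a. v a \<in> A a" by metis
  with x have "v(a := x) \<in> Pi UNIV A" by auto
  with sub have "v(a := x) \<in> Pi UNIV B" by blast
  then show "x \<in> B a" by (auto dest: Pi_mem[of _ _ _ a])
qed auto

text \<open>A complex with \<open>n a\<close> subintervals on axis \<open>a\<close>, whose subdivision points are \<open>t a 0, \<dots>, t a (n a)\<close>.\<close>
locale cubical_complex =
  fixes lo hi :: "axis \<Rightarrow> real" and n :: "axis \<Rightarrow> nat" and t :: "axis \<Rightarrow> nat \<Rightarrow> real"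
  assumes subdivision: "\<And>a. subdivision (lo a) (hi a) (n a) (t a)"
begin

lemma t_le_iff: "i \<le> n a \<Longrightarrow> j \<le> n a \<Longrightarrow> t a i \<le> t a j \<longleftrightarrow> i \<le> j"
  using subdivision_le_iff[OF subdivision] .

lemma t_eq_iff: "i \<le> n a \<Longrightarrow> j \<le> n a \<Longrightarrow> t a i = t a j \<longleftrightarrow> i = j"
  using t_le_iff by (metis order_antisym order_refl)

text \<open>The projection of a cell to one axis.\<close>
definition side :: "axis list \<Rightarrow> (axis \<Rightarrow> nat) \<Rightarrow> axis \<Rightarrow> real set" where
  "side T i a = (if a \<in> set T then {t a (i a)..t a (Suc (i a))} else {t a (i a)})"

lemma cell_set_eq_Pi: "cell_set t (Cell T i) = Pi UNIV (side T i)"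
  by (auto simp: cell_set_def side_def Pi_def split: if_splits)

lemma side_subset_iff:
  assumes "i a < index_count n T a" "i' a < index_count n T' a"
  shows "side T' i' a \<subseteq> side T i a \<longleftrightarrow>
    (if a \<in> set T' then a \<in> set T \<and> i' a = i a
     else if a \<in> set T then i' a = i a \<or> i' a = Suc (i a) else i' a = i a)"
proof (cases "a \<in> set T'")
  case True
  then have i': "Suc (i' a) \<le> n a" using assms by (simp add: index_count_def)
  then have le: "t a (i' a) < t a (Suc (i' a))" using t_le_iff[of "Suc (i' a)" a "i' a"] by simp
  show ?thesis
  proof (cases "a \<in> set T")
    case T: True
    then have "Suc (i a) \<le> n a" using assms by (simp add: index_count_def)
    with i' le show ?thesis
      using True T by (auto simp: side_def t_le_iff t_eq_iff)
  next
    case False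
    have "t a (i' a) \<in> side T' i' a" "t a (Suc (i' a)) \<in> side T' i' a"
      using True le by (auto simp: side_def)
    moreover have "side T i a = {t a (i a)}" using False by (simp add: side_def)
    ultimately have "\<not> side T' i' a \<subseteq> side T i a"
      using le by (metis less_irrefl singletonD subsetD)
    then show ?thesis using True False by simp
  qed
next
  case False
  then have "i' a \<le> n a" using assms by (simp add: index_count_def)
  then show ?thesis
    using False assms by (auto simp: side_def index_count_def t_le_iff t_eq_iff le_Suc_eq
        split: if_splits)
qed

lemma cell_subset_iff:
  assumes "admissible n T i" "admissible n T' i'"
  shows "cell_set t (Cell T' i') \<subseteq> cell_set t (Cell T i) \<longleftrightarrow>
    (\<forall>a. if a \<in> set T' then a \<in> set T \<and> i' a = i a
         else if a \<in> set T then i' a = i a \<or> i' a = Suc (i a) else i' a = i a)"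
proof -
  have "side T' i' a \<noteq> {}" for a
    using assms(2) t_le_iff[of "i' a" a "Suc (i' a)"]
    by (auto simp: side_def admissible_def index_count_def split: if_splits dest!: spec[of _ a])
  then show ?thesis
    using Pi_UNIV_subset_iff[of "side T' i'" "side T i"] side_subset_iff assms
    by (simp add: cell_set_eq_Pi admissible_def)
qed

text \<open>A cell inside \<open>Cell T i\<close> whose projection to some axis of \<open>T\<close> is a single point lies on the
  boundary, because that point is a subdivision point and hence an end of the interval.\<close>
lemma cell_subset_boundary_iff:
  assumes "admissible n T i" "admissible n T' i'" "\<not> set T \<subseteq> set T'"
  shows "cell_set t (Cell T' i') \<subseteq> cell_boundary t (Cell T i)
     \<longleftrightarrow> cell_set t (Cell T' i') \<subseteq> cell_set t (Cell T i)"
proof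
  assume sub: "cell_set t (Cell T' i') \<subseteq> cell_set t (Cell T i)"
  obtain a where a: "a \<in> set T" "a \<notin> set T'" using assms(3) by blast
  then have "i' a = i a \<or> i' a = Suc (i a)"
    using sub unfolding cell_subset_iff[OF assms(1,2)] by metis
  moreover have "v a = t a (i' a)" if "v \<in> cell_set t (Cell T' i')" for v
    using that a by (auto simp: cell_set_def split: if_splits dest: spec[of _ a])
  ultimately show "cell_set t (Cell T' i') \<subseteq> cell_boundary t (Cell T i)"
    using sub a(1) by (fastforce simp: cell_boundary_def)
qed (auto simp: cell_boundary_def)

text \<open>If the axes of \<open>T'\<close> are not among those of \<open>T\<close>, then no cell of type \<open>T'\<close> lies on the boundary
  of a cell of type \<open>T\<close>, and \<open>facet_sign T T'\<close> vanishes by definition.\<close>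
lemma incidence_eq:
  assumes T: "T \<in> set (cell_types (Suc p))" "T' \<in> set (cell_types p)"
    and adm: "admissible n T i" "admissible n T' i'"
  shows "incidence t (Cell T i) (Cell T' i')
       = facet_sign T T' * (\<Prod>a\<in>UNIV. coord_inc T T' a (i a) (i' a))"
proof -
  have "\<not> set T \<subseteq> set T'"
    using T by (cases rule: cell_types_cases) auto
  then have "incidence t (Cell T i) (Cell T' i') =
      (if \<forall>a. if a \<in> set T' then a \<in> set T \<and> i' a = i a
              else if a \<in> set T then i' a = i a \<or> i' a = Suc (i a) else i' a = i a
       then if coherent (Cell T i) (Cell T' i') then 1 else -1 else 0)"
    using cell_subset_boundary_iff[OF adm] cell_subset_iff[OF adm] by (simp add: incidence_def)
  also have "\<dots> = facet_sign T T' * (\<Prod>a\<in>UNIV. coord_inc T T' a (i a) (i' a))"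
    using T
  proof (cases rule: cell_types_cases)
    case (0 a)
    then show ?thesis
      by (cases a) (auto simp: all_axis prod_axis coord_inc_def coherent_values facet_sign_values)
  next
    case (1 a)
    then show ?thesis
      by (cases a) (auto simp: all_axis prod_axis coord_inc_def coherent_values facet_sign_values)
  next
    case 2
    then show ?thesis
      by (auto simp: all_axis prod_axis coord_inc_def coherent_values facet_sign_values)
  qed
  finally show ?thesis .
qed

section \<open>The exterior derivative squares to zero\<close>

lemma ext_deriv_carrier: "ext_deriv n t p \<in> carrier_mat (num_cells n (Suc p)) (num_cells n p)"
  by (simp add: ext_deriv_def)

lemma ext_deriv_ext_deriv:
  "ext_deriv n t (Suc p) * ext_deriv n t p = 0\<^sub>m (num_cells n (Suc (Suc p))) (num_cells n p)"
proof (rule eq_matI)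
  fix r c
  assume "r < dim_row (0\<^sub>m (num_cells n (Suc (Suc p))) (num_cells n p) :: real mat)"
    and "c < dim_col (0\<^sub>m (num_cells n (Suc (Suc p))) (num_cells n p) :: real mat)"
  then have r: "r < num_cells n (Suc (Suc p))" and c: "c < num_cells n p" by simp_all
  let ?\<sigma> = "cells n (Suc (Suc p)) ! r" and ?\<rho> = "cells n p ! c"
  have "?\<sigma> \<in> set (cells n (Suc (Suc p)))" "?\<rho> \<in> set (cells n p)"
    using r c by (simp_all add: num_cells_def)
  then obtain T i T'' k
    where \<sigma>: "?\<sigma> = Cell T i" "T \<in> set (cell_types (Suc (Suc p)))" "admissible n T i"
      and \<rho>: "?\<rho> = Cell T'' k" "T'' \<in> set (cell_types p)" "admissible n T'' k"
    unfolding set_cells by blast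
  let ?P = "\<Prod>a\<in>UNIV. coord_inc T T'' a (i a) (k a)"
  let ?g = "\<lambda>T' a y. coord_inc T T' a (i a) y * coord_inc T' T'' a y (k a)"
  have block: "sum_list (map (\<lambda>\<tau>. incidence t ?\<sigma> \<tau> * incidence t \<tau> ?\<rho>) (cells_of_type n T'))
      = facet_sign T T' * facet_sign T' T'' * ?P" if T': "T' \<in> set (cell_types (Suc p))" for T'
  proof -
    have "incidence t ?\<sigma> \<tau> * incidence t \<tau> ?\<rho>
        = facet_sign T T' * facet_sign T' T'' * (\<Prod>a\<in>UNIV. ?g T' a (idx \<tau> a))"
      if \<tau>: "\<tau> \<in> set (cells_of_type n T')" for \<tau>
    proof -
      obtain j where j: "\<tau> = Cell T' j" "admissible n T' j"
        using \<tau> unfolding set_cells_of_type by blast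
      show ?thesis
        unfolding \<sigma>(1) \<rho>(1) j(1)
        using incidence_eq[OF \<sigma>(2) T' \<sigma>(3) j(2)] incidence_eq[OF T' \<rho>(2) j(2) \<rho>(3)]
        by (simp add: prod.distrib)
    qed
    then have "sum_list (map (\<lambda>\<tau>. incidence t ?\<sigma> \<tau> * incidence t \<tau> ?\<rho>) (cells_of_type n T'))
      = sum_list (map (\<lambda>\<tau>. facet_sign T T' * facet_sign T' T'' * (\<Prod>a\<in>UNIV. ?g T' a (idx \<tau> a)))
          (cells_of_type n T'))"
      by (metis (no_types, lifting) map_cong)
    also have "\<dots> = facet_sign T T' * facet_sign T' T'' *
        (\<Prod>a\<in>UNIV. \<Sum>y<index_count n T' a. ?g T' a y)"
      by (simp only: sum_list_const_mult sum_list_cells_of_type_prod[of "?g T'"])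
    also have "\<dots> = facet_sign T T' * facet_sign T' T'' * ?P"
    proof (cases "set T'' \<subseteq> set T' \<and> set T' \<subseteq> set T")
      case True
      then have "(\<Sum>y<index_count n T' a. ?g T' a y) = coord_inc T T'' a (i a) (k a)" for a
        using \<sigma>(3) \<rho>(3) by (intro coord_inc_comp) (auto simp: admissible_def)
      then show ?thesis by simp
    next
      case False
      then show ?thesis by (auto simp: facet_sign_def)
    qed
    finally show ?thesis .
  qed
  have "(ext_deriv n t (Suc p) * ext_deriv n t p) $$ (r, c)
      = (\<Sum>l<length (cells n (Suc p)). incidence t ?\<sigma> (cells n (Suc p) ! l)
            * incidence t (cells n (Suc p) ! l) ?\<rho>)"
    using r c by (simp add: ext_deriv_def scalar_prod_def atLeast0LessThan num_cells_def)
  also have "\<dots> = sum_list (map (\<lambda>\<tau>. incidence t ?\<sigma> \<tau> * incidence t \<tau> ?\<rho>) (cells n (Suc p)))"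
    by (simp add: sum_list_sum_nth atLeast0LessThan)
  also have "\<dots> = sum_list (map (\<lambda>T'. sum_list (map (\<lambda>\<tau>. incidence t ?\<sigma> \<tau> * incidence t \<tau> ?\<rho>)
                    (cells_of_type n T'))) (cell_types (Suc p)))"
  proof -
    have "sum_list (map f (concat xss)) = sum_list (map (\<lambda>xs. sum_list (map f xs)) xss)"
      for f :: "cell \<Rightarrow> real" and xss
      by (induction xss) simp_all
    then show ?thesis by (simp add: cells_def comp_def)
  qed
  also have "\<dots> = sum_list (map (\<lambda>T'. facet_sign T T' * facet_sign T' T'' * ?P) (cell_types (Suc p)))"
    using block by (metis (no_types, lifting) map_cong)
  also have "\<dots> = 0"
    using sum_facet_sign_eq_0[OF \<sigma>(2) \<rho>(2)] by (simp add: sum_list_mult_const)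
  finally show "(ext_deriv n t (Suc p) * ext_deriv n t p) $$ (r, c)
      = 0\<^sub>m (num_cells n (Suc (Suc p))) (num_cells n p) $$ (r, c)"
    using r c by simp
qed (simp_all add: ext_deriv_def)

section \<open>Generalized incidence as a Kronecker product\<close>

text \<open>The edges of a cell at one of its vertices: one for each direction of the cell, and its lower
  endpoint has, along that direction, the index of the cell itself.\<close>
lemma edges_at_vertex:
  assumes adm: "admissible n T i" "admissible n [] i'"
    and vertex: "cell_set t (Cell [] i') \<subseteq> cell_set t (Cell T i)"
  shows "{e. e \<in> set (cells n 1) \<and> cell_set t e \<subseteq> cell_set t (Cell T i)
            \<and> cell_set t (Cell [] i') \<subseteq> cell_set t e}
       = (\<lambda>a. Cell [a] (i'(a := i a))) ` set T" (is "?E = ?F")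
proof
  have v: "\<And>a. if a \<in> set T then i' a = i a \<or> i' a = Suc (i a) else i' a = i a"
    using vertex unfolding cell_subset_iff[OF adm] by simp
  have types: "set (cell_types 1) = range (\<lambda>a. [a])"
    by (auto simp: cell_types_def UNIV_axis)
  show "?E \<subseteq> ?F"
  proof
    fix e assume e: "e \<in> ?E"
    then obtain b k where k: "e = Cell [b] k" "admissible n [b] k"
      unfolding set_cells types by auto
    have 1: "\<And>a. if a = b then a \<in> set T \<and> k a = i a
               else if a \<in> set T then k a = i a \<or> k a = Suc (i a) else k a = i a"
      using e unfolding k(1) mem_Collect_eq cell_subset_iff[OF adm(1) k(2)] by simp
    have 2: "\<And>a. if a = b then i' a = k a \<or> i' a = Suc (k a) else i' a = k a"
      using e unfolding k(1) mem_Collect_eq cell_subset_iff[OF k(2) adm(2)] by simp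
    have "k = i'(b := i b)" using 1[of b] 2 by (auto simp: fun_eq_iff)
    moreover have "b \<in> set T" using 1[of b] by simp
    ultimately show "e \<in> ?F" using k(1) by blast
  qed
  show "?F \<subseteq> ?E"
  proof
    fix e assume "e \<in> ?F"
    then obtain b where b: "b \<in> set T" "e = Cell [b] (i'(b := i b))" by blast
    have k: "admissible n [b] (i'(b := i b))"
      using adm b(1) by (auto simp: admissible_def index_count_def dest: spec[of _ b])
    have "cell_set t e \<subseteq> cell_set t (Cell T i)"
      unfolding b(2) cell_subset_iff[OF adm(1) k] using v b(1) by auto
    moreover have "cell_set t (Cell [] i') \<subseteq> cell_set t e"
      unfolding b(2) cell_subset_iff[OF k adm(2)] using v[of b] b(1) by auto
    moreover have "e \<in> set (cells n 1)"
      unfolding set_cells types using b(2) k by blast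
    ultimately show "e \<in> ?E" by blast
  qed
qed

text \<open>There is no sign here: an edge has incidence number \<open>1\<close> with its upper endpoint, whatever its
  direction.\<close>
lemma gen_incidence_eq:
  assumes T: "T \<in> set (cell_types (Suc q))"
    and adm: "admissible n T i" "admissible n [] i'"
  shows "gen_incidence n t (Cell T i) (Cell [] i') = (\<Prod>a\<in>UNIV. coord_inc T [] a (i a) (i' a))"
proof -
  have nil: "[] \<in> set (cell_types 0)" by (simp add: cell_types_def)
  have edge: "incidence t (Cell [a] k) (Cell [] i') = (\<Prod>b\<in>UNIV. coord_inc [a] [] b (k b) (i' b))"
    if "admissible n [a] k" for a k
  proof -
    have "[a] \<in> set (cell_types (Suc 0))" by (cases a) (simp_all add: cell_types_def)
    moreover have "facet_sign [a] [] = 1" by (cases a) (simp_all add: facet_sign_values)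
    ultimately show ?thesis using incidence_eq[OF _ nil that adm(2)] by simp
  qed
  consider a where "T = [a]" | "length T \<noteq> 1" "cell_set t (Cell [] i') \<subseteq> cell_set t (Cell T i)"
    | "length T \<noteq> 1" "\<not> cell_set t (Cell [] i') \<subseteq> cell_set t (Cell T i)"
    by (cases T; cases "tl T") auto
  then show ?thesis
  proof cases
    case (1 a)
    then show ?thesis using edge[of a i] adm(1) by (simp add: gen_incidence_def)
  next
    case 2
    have v: "\<And>a. if a \<in> set T then i' a = i a \<or> i' a = Suc (i a) else i' a = i a"
      using 2(2) unfolding cell_subset_iff[OF adm] by simp
    have inj: "inj_on (\<lambda>a. Cell [a] (i'(a := i a))) (set T)" by (auto intro: inj_onI)
    have "gen_incidence n t (Cell T i) (Cell [] i')
        = (\<Prod>a\<in>set T. incidence t (Cell [a] (i'(a := i a))) (Cell [] i'))"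
      using 2 unfolding gen_incidence_def edges_at_vertex[OF adm 2(2)]
      by (simp add: prod.reindex[OF inj] comp_def)
    also have "\<dots> = (\<Prod>a\<in>set T. coord_inc T [] a (i a) (i' a))"
    proof (rule prod.cong)
      fix a assume a: "a \<in> set T"
      have k: "admissible n [a] (i'(a := i a))"
        using adm a by (auto simp: admissible_def index_count_def dest: spec[of _ a])
      have "incidence t (Cell [a] (i'(a := i a))) (Cell [] i')
          = (\<Prod>b\<in>UNIV. if b = a then coord_inc T [] a (i a) (i' a) else 1)"
        unfolding edge[OF k] using a by (intro prod.cong) (auto simp: coord_inc_def)
      then show "incidence t (Cell [a] (i'(a := i a))) (Cell [] i') = coord_inc T [] a (i a) (i' a)"
        by simp
    qed simp
    also have "\<dots> = (\<Prod>a\<in>UNIV. coord_inc T [] a (i a) (i' a))"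
      using v by (intro prod.mono_neutral_left) (auto simp: coord_inc_def)
    finally show ?thesis .
  next
    \<comment> \<open>If the node is not a vertex, it lies off the cell on some axis, where the factor vanishes.\<close>
    case 3
    then obtain a where "\<not> (if a \<in> set T then i' a = i a \<or> i' a = Suc (i a) else i' a = i a)"
      unfolding cell_subset_iff[OF adm] by auto
    then have "coord_inc T [] a (i a) (i' a) = 0"
      by (auto simp: coord_inc_def split: if_splits)
    then have "(\<Prod>a\<in>UNIV. coord_inc T [] a (i a) (i' a)) = 0"
      by (intro prod_zero) auto
    then show ?thesis using 3 by (simp add: gen_incidence_def)
  qed
qed

text \<open>The factor of axis \<open>a\<close> in the generalized incidence matrix of the cells of type \<open>T\<close>.\<close>
definition D_factor :: "axis list \<Rightarrow> axis \<Rightarrow> real mat" where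
  "D_factor T a = (if a \<in> set T then D_axis (n a) else 1\<^sub>m (n a + 1))"

lemma D_factor_carrier: "D_factor T a \<in> carrier_mat (index_count n T a) (n a + 1)"
  by (simp add: D_factor_def D_axis_def index_count_def)

lemma D_factor_index:
  assumes "x < index_count n T a" "y < n a + 1"
  shows "D_factor T a $$ (x, y) = coord_inc T [] a x y"
  using assms by (auto simp: D_factor_def D_axis_def index_count_def coord_inc_def)

lemma B_block_eq_kron:
  assumes T: "T \<in> set (cell_types (Suc q))"
  shows "B_block n t T = kron (kron (D_factor T XX) (D_factor T YY)) (D_factor T ZZ)"
proof (rule eq_matI)
  let ?N = "index_count n T" and ?M = "index_count n []"
  have dims[simp]: "dim_row (D_factor T a) = ?N a" "dim_col (D_factor T a) = ?M a" for a
    using D_factor_carrier[of T a] by (auto simp: index_count_def)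
  have cells0: "cells n 0 = cells_of_type n []" by (simp add: cells_def cell_types_def)
  show "dim_row (B_block n t T) = dim_row (kron (kron (D_factor T XX) (D_factor T YY)) (D_factor T ZZ))"
    "dim_col (B_block n t T) = dim_col (kron (kron (D_factor T XX) (D_factor T YY)) (D_factor T ZZ))"
    by (simp_all add: B_block_def length_cells_of_type num_cells_def cells0)
  fix r c
  assume "r < dim_row (kron (kron (D_factor T XX) (D_factor T YY)) (D_factor T ZZ))"
    and "c < dim_col (kron (kron (D_factor T XX) (D_factor T YY)) (D_factor T ZZ))"
  then have r: "r < ?N XX * ?N YY * ?N ZZ" and c: "c < ?M XX * ?M YY * ?M ZZ" by simp_all
  note br = div_mod_bounds[OF r] div_mod_bounds[OF div_mod_bounds(1)[OF r]]
  note bc = div_mod_bounds[OF c] div_mod_bounds[OF div_mod_bounds(1)[OF c]]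
  let ?i = "multi_index (r div ?N ZZ div ?N YY) (r div ?N ZZ mod ?N YY) (r mod ?N ZZ)"
  let ?k = "multi_index (c div ?M ZZ div ?M YY) (c div ?M ZZ mod ?M YY) (c mod ?M ZZ)"
  have adm: "admissible n T ?i" "admissible n [] ?k"
    using br bc by (simp_all add: admissible_def all_axis)
  have "B_block n t T $$ (r, c) = gen_incidence n t (Cell T ?i) (Cell [] ?k)"
    using r c by (simp add: B_block_def length_cells_of_type num_cells_def cells0 nth_cells_of_type)
  also have "\<dots> = (\<Prod>a\<in>UNIV. coord_inc T [] a (?i a) (?k a))"
    by (rule gen_incidence_eq[OF T adm])
  also have "\<dots> = (\<Prod>a\<in>UNIV. D_factor T a $$ (?i a, ?k a))"
    using adm by (intro prod.cong refl D_factor_index[symmetric])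
      (auto simp: admissible_def index_count_def[of n "[]"])
  also have "\<dots> = kron (kron (D_factor T XX) (D_factor T YY)) (D_factor T ZZ) $$ (r, c)"
    using r c br bc by (simp add: prod_axis kron_def)
  finally show "B_block n t T $$ (r, c)
      = kron (kron (D_factor T XX) (D_factor T YY)) (D_factor T ZZ) $$ (r, c)" .
qed

section \<open>Invertibility of the fractional integrals\<close>

lemma M_factor_carrier: "M_factor \<beta> n t T a \<in> carrier_mat (n a + 1) (index_count n T a)"
  by (simp add: M_factor_def M_axis_def index_count_def)

lemma invertible_D_factor_M_factor:
  assumes "0 < \<beta>"
  shows "invertible_mat (D_factor T a * M_factor \<beta> n t T a)"
  using invertible_D_axis_M_axis[OF subdivision assms] invertible_one_mat[where ?'a = real]
  by (simp add: D_factor_def M_factor_def)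

text \<open>The diagonal block of \<open>M_mat\<close> that belongs to the cells of type \<open>T\<close>.\<close>
definition M_block :: "real \<Rightarrow> axis list \<Rightarrow> real mat" where
  "M_block \<beta> T = kron (kron (M_factor \<beta> n t T XX) (M_factor \<beta> n t T YY)) (M_factor \<beta> n t T ZZ)"

lemma M_block_carrier: "M_block \<beta> T \<in> carrier_mat (num_cells n 0) (length (cells_of_type n T))"
proof -
  have "num_cells n 0 = (n XX + 1) * (n YY + 1) * (n ZZ + 1)"
    by (simp add: num_cells_eq_sum cell_types_def length_cells_of_type index_count_def)
  then show ?thesis
    unfolding M_block_def length_cells_of_type
    by (simp only:) (intro kron_carrier M_factor_carrier)
qed

lemma B_block_carrier: "B_block n t T \<in> carrier_mat (length (cells_of_type n T)) (num_cells n 0)"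
  by (simp add: B_block_def)

lemma invertible_B_block_M_block:
  assumes T: "T \<in> set (cell_types (Suc q))" and "0 < \<beta>"
  shows "invertible_mat (B_block n t T * M_block \<beta> T)"
proof -
  let ?D = "D_factor T" and ?M = "M_factor \<beta> n t T"
  have dim: "dim_col (?D a) = dim_row (?M a)" for a
    using D_factor_carrier[of T a] M_factor_carrier[of \<beta> T a] by auto
  have "B_block n t T * M_block \<beta> T
      = kron (kron (?D XX * ?M XX) (?D YY * ?M YY)) (?D ZZ * ?M ZZ)"
    unfolding B_block_eq_kron[OF T] M_block_def by (simp add: kron_mult dim)
  moreover have c: "?D a * ?M a \<in> carrier_mat (index_count n T a) (index_count n T a)" for a
    using D_factor_carrier M_factor_carrier by (rule mult_carrier_mat)
  moreover note i = invertible_D_factor_M_factor[OF assms(2), of T]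
  ultimately show ?thesis
    using invertible_kron[OF invertible_kron[OF i c i c] kron_carrier[OF c c] i c] by simp
qed

lemma B_mat_M_mat:
  "B_mat n t p * M_mat \<beta> n t p
   = diag_block_mat (map (\<lambda>T. B_block n t T * M_block \<beta> T) (cell_types p))"
  unfolding B_mat_def M_mat_def M_block_def[symmetric]
  by (rule diag_block_mat_mult) (metis B_block_carrier M_block_carrier carrier_matD)

lemma B_block_M_block_carrier:
  "B_block n t T * M_block \<beta> T
     \<in> carrier_mat (length (cells_of_type n T)) (length (cells_of_type n T))"
  using B_block_carrier M_block_carrier by (rule mult_carrier_mat)

lemma B_mat_M_mat_carrier:
  "B_mat n t p * M_mat \<beta> n t p \<in> carrier_mat (num_cells n p) (num_cells n p)"
  unfolding B_mat_M_mat num_cells_eq_sum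
  by (rule diag_block_mat_carrier) (rule B_block_M_block_carrier)

lemma invertible_B_mat_M_mat:
  assumes "0 < \<beta>"
  shows "invertible_mat (B_mat n t (Suc q) * M_mat \<beta> n t (Suc q))"
  unfolding B_mat_M_mat
  by (rule invertible_diag_block_mat[OF B_block_M_block_carrier invertible_B_block_M_block[OF _ assms]])

lemma V_mat_carrier: "V_mat n t p \<in> carrier_mat (num_cells n p) (num_cells n p)"
  by (simp add: V_mat_def)

lemma cell_size_pos:
  assumes "\<sigma> \<in> set (cells n p)"
  shows "0 < cell_size t \<sigma>"
proof -
  obtain T i where \<sigma>: "\<sigma> = Cell T i" "admissible n T i"
    using assms unfolding set_cells by blast
  have "0 < t a (Suc (i a)) - t a (i a)" if "a \<in> set T" for a
  proof -
    have "i a < n a" using \<sigma>(2) that by (auto simp: admissible_def index_count_def dest: spec[of _ a])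
    then show ?thesis using subdivision[of a] by (simp add: subdivision_def)
  qed
  then show ?thesis unfolding \<sigma>(1) cell_size_def by (auto intro!: prod_pos)
qed

lemma invertible_V_mat: "invertible_mat (V_mat n t p)"
proof -
  let ?s = "\<lambda>i. cell_size t (cells n p ! i)"
  have "?s i \<noteq> 0" if "i < num_cells n p" for i
    using cell_size_pos[of "cells n p ! i" p] that by (simp add: num_cells_def)
  then have "V_mat n t p * mat_diag (num_cells n p) (\<lambda>i. 1 / ?s i) = 1\<^sub>m (num_cells n p)"
    unfolding V_mat_def mat_diag_diag by (intro eq_matI) (auto simp: mat_diag_def)
  then show ?thesis
    by (intro invertible_matI[OF V_mat_carrier]) (auto simp: mat_diag_dim)
qed

lemma frac_int_carrier: "frac_int \<beta> n t p \<in> carrier_mat (num_cells n p) (num_cells n p)"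
  unfolding frac_int_def
  using mult_carrier_mat[OF B_mat_M_mat_carrier mat_inv(1)[OF invertible_V_mat V_mat_carrier]]
  by simp

lemma invertible_frac_int:
  assumes "0 < \<beta>"
  shows "invertible_mat (frac_int \<beta> n t p)"
proof (cases p)
  case (Suc q)
  then show ?thesis
    using invertible_mat_mult[OF invertible_B_mat_M_mat[OF assms] B_mat_M_mat_carrier
        invertible_mat_inv[OF invertible_V_mat V_mat_carrier]
        mat_inv(1)[OF invertible_V_mat V_mat_carrier]]
    by (simp add: frac_int_def)
qed (simp add: frac_int_def invertible_one_mat)

section \<open>The fractional exterior derivative\<close>

lemma frac_ext_deriv_frac_ext_deriv:
  assumes "\<alpha> < 1"
  shows "frac_ext_deriv \<alpha> n t (Suc p) * frac_ext_deriv \<alpha> n t p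
       = 0\<^sub>m (num_cells n (Suc (Suc p))) (num_cells n p)"
proof -
  have inv: "invertible_mat (frac_int (1 - \<alpha>) n t k)" for k
    using assms by (intro invertible_frac_int) simp
  note inverse = mat_inv[OF inv frac_int_carrier]
  show ?thesis
    unfolding frac_ext_deriv_def
    using mult_interleave[OF frac_int_carrier ext_deriv_carrier frac_int_carrier inverse(1)
        ext_deriv_carrier inverse(1) inverse(3) ext_deriv_ext_deriv]
    by simp
qed

end

theorem mainTheorem3:
  fixes \<alpha> :: real
    and lo hi :: "axis \<Rightarrow> real"
    and n :: "axis \<Rightarrow> nat"
    and t :: "axis \<Rightarrow> nat \<Rightarrow> real"
  assumes "0 < \<alpha>" and "\<alpha> < 1"
    and "\<And>a. subdivision (lo a) (hi a) (n a) (t a)"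
  shows "(\<forall>p \<in> {0, 1, 2}. invertible_mat (frac_int (1 - \<alpha>) n t p)) \<and>
         (\<forall>p \<in> {0, 1}. frac_ext_deriv \<alpha> n t (p + 1) * frac_ext_deriv \<alpha> n t p
                        = 0\<^sub>m (num_cells n (p + 2)) (num_cells n p))"
proof -
  interpret cubical_complex lo hi n t
    by unfold_locales (rule assms(3))
  show ?thesis
    using invertible_frac_int frac_ext_deriv_frac_ext_deriv[OF assms(2)] assms(2) by simp
qed

end
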